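(* Let $\{\mathbf{X}^k\}$ be the sequence generated by the algorithm CWOA (described in the context) for the problem $\min_{\mathbf{X}\in\mathbb{R}^{n\times n}} f(\mathbf{X})$ s.t. $\mathbf{X}\succ\mathbf{0}$, $\|\mathbf{X}\|_{0,\mathrm{off}}\le s$. Then CWOA outputs a coordinate-wise minimum point $\mathbf{X}^*$ with $f(\mathbf{X}^* )\le f(\mathbf{P})$ for every $\mathbf{P}\in\mathcal{N}$, where $$\mathcal{N}\triangleq\{\mathbf{X}\;|\;\mathbf{X}\succ\mathbf{0},\ \|\mathbf{X}^*-\mathbf{X}\|_0\le 2\}.$$
   Context: Let $\mathbf{\Sigma}\in\mathbb{R}^{n\times n}$ be a given symmetric covariance matrix of a data set, $s$ a positive integer (the sparsity level), and $f(\mathbf{X})=\langle\mathbf{\Sigma},\mathbf{X}\rangle-\log\det(\mathbf{X})$, where $\langle\cdot,\cdot\rangle$ is the standard inner product. $\mathbf{X}\succ\mathbf{0}$ means that $\mathbf{X}$ is (symmetric) positive definite. $\|\mathbf{X}\|_{0,\mathrm{off}}$ is the number of non-diagonal non-zero elements of the square matrix $\mathbf{X}$, and $\|\mathbf{X}\|_0$ is the $\ell_0$ norm, i.e. the number of non-zero elements of $\mathbf{X}$. Positions in an $n\times n$ matrix are numbered $1,\dots,n^2$ (column-stacked), and $\mathbf{X}_j$ is the element at position $j$. For a position $j$ in row $r$ and column $c$, $\mathbf{E}_j$ is the symmetric $n\times n$ matrix whose entries $(r,c)$ and $(c,r)$ equal 1 and whose other entries are 0. $\bar{\mathcal{S}}(\mathbf{X})$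 and $\bar{\mathcal{Z}}(\mathbf{X})$ denote the sets of non-diagonal positions at which $\mathbf{X}$ is non-zero and zero, respectively. For a support set $S$, the reduced convex problem over $S$ is: minimize $f(\mathbf{X})$ over $\mathbf{X}\succ\mathbf{0}$ subject to $\mathbf{X}$ being zero at all positions outside $S$; here the diagonal positions are always free (never forced to zero), and a non-diagonal position is added to or removed from $S$ together with its transposed position. Algorithm CWOA. Input: $s$. Initialize $\mathbf{X}^0=\mathbf{O}^{-1}$, where $\mathbf{O}$ is the diagonal matrix with $\mathbf{O}_{ii}=\mathbf{\Sigma}_{ii}$ for all $i$, and $k=0$. Repeat the following two stages until the stop below. Greedy pursuit stage: while $\|\mathbf{X}^k\|_{0,\mathrm{off}}<s$: for every $j\in\bar{\mathcal{Z}}(\mathbf{X}^k)$ compute $f_j=\min_\theta f(\mathbf{X}^k+\theta\mathbf{E}_j)$ s.t. $\mathbf{X}^k+\theta\mathbf{E}_j\succ\mathbf{0}$; let $j_k=\arg\min\{f_j:j\in\bar{\mathcal{Z}}(\mathbf{X}^k)\}$; if $f_{j_k}<f(\mathbf{X}^k)$, solve the reduced convex problem over $S=\bar{\mathcal{S}}(\mathbf{X}^k)\cup\{j_k\}$ to get $\mathbf{X}^{k+1}$ and set $k\leftarrow k+1$. Swap coordinates stage: for every $i\in\bar{\mathcal{S}}(\mathbf{X}^k)$ and every $j\in\bar{\mathcal{Z}}(\mathbf{X}^k)$ compute $f_{i,j}=\min_\theta f(\mathbf{X}^k-\mathbf{X}^k_i\mathbf{E}_i+\theta\mathbf{E}_j)$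 s.t. $\mathbf{X}^k-\mathbf{X}^k_i\mathbf{E}_i+\theta\mathbf{E}_j\succ\mathbf{0}$; let $(i_k,j_k)=\arg\min\{f_{i,j}:i\in\bar{\mathcal{S}}(\mathbf{X}^k),\,j\in\bar{\mathcal{Z}}(\mathbf{X}^k)\}$. If $f_{i_k,j_k}<f(\mathbf{X}^k)$, solve the reduced convex problem over $S=(\bar{\mathcal{S}}(\mathbf{X}^k)\setminus\{i_k\})\cup\{j_k\}$ to get $\mathbf{X}^{k+1}$, set $k\leftarrow k+1$, and return to the greedy pursuit stage; otherwise set $\mathbf{X}^*=\mathbf{X}^k$ and stop.
   Formalization: P in N is compared only if ‖P‖_{0,off} ≤ s (else the claim is false); for odd s, feasibility of X* and P uses s+1. The greedy stage ends when no candidate decreases f; all Σ_ii are non-zero, and the reduced problems that occur are assumed solvable. *)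

theory Defs
  imports "HOL-Analysis.Analysis"
begin

type_synonym 'n sqmat = "real ^ 'n ^ 'n"

definition posdef :: "'n::finite sqmat \<Rightarrow> bool" where
  "posdef A \<longleftrightarrow> transpose A = A \<and> (\<forall>x. x \<noteq> 0 \<longrightarrow> 0 < x \<bullet> (A *v x))"

definition covariance_matrix :: "'n::finite sqmat \<Rightarrow> bool" where
  "covariance_matrix A \<longleftrightarrow> transpose A = A \<and> (\<forall>x. 0 \<le> x \<bullet> (A *v x))"

definition objective :: "'n::finite sqmat \<Rightarrow> 'n sqmat \<Rightarrow> real" where
  "objective \<Sigma> X = \<Sigma> \<bullet> X - ln (det X)"

(* A position is a pair (row, column); the numbering 1, ..., n^2 of the positions is immaterial. *)

definition entry :: "'n::finite sqmat \<Rightarrow> 'n \<times> 'n \<Rightarrow> real" where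
  "entry X p = X $ fst p $ snd p"

definition off_diagonal :: "('n \<times> 'n) set" where
  "off_diagonal = {p. fst p \<noteq> snd p}"

definition off_support :: "'n::finite sqmat \<Rightarrow> ('n \<times> 'n) set" where
  "off_support X = {p \<in> off_diagonal. entry X p \<noteq> 0}"

definition off_zeros :: "'n::finite sqmat \<Rightarrow> ('n \<times> 'n) set" where
  "off_zeros X = {p \<in> off_diagonal. entry X p = 0}"

definition l0 :: "'n::finite sqmat \<Rightarrow> nat" where
  "l0 X = card {p. entry X p \<noteq> 0}"

definition l0_off :: "'n::finite sqmat \<Rightarrow> nat" where
  "l0_off X = card (off_support X)"

definition sym_unit :: "'n::finite \<times> 'n \<Rightarrow> 'n sqmat" where
  "sym_unit p = (\<chi> i j. if (i, j) = p \<or> (j, i) = p then 1 else 0)"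

(* The minimum over t of f (Y + t E_p) subject to Y + t E_p being positive definite, as an
   extended real: its value is infinity if no t is admissible, which can happen in the swap stage,
   since zeroing an entry of a positive definite matrix may destroy definiteness. *)
definition line_min :: "'n::finite sqmat \<Rightarrow> 'n sqmat \<Rightarrow> 'n \<times> 'n \<Rightarrow> ereal" where
  "line_min \<Sigma> Y p =
     (INF t\<in>{t. posdef (Y + t *\<^sub>R sym_unit p)}. ereal (objective \<Sigma> (Y + t *\<^sub>R sym_unit p)))"

definition swap_min :: "'n::finite sqmat \<Rightarrow> 'n sqmat \<Rightarrow> ('n \<times> 'n) \<times> ('n \<times> 'n) \<Rightarrow> ereal" where
  "swap_min \<Sigma> X = (\<lambda>(i, j). line_min \<Sigma> (X - entry X i *\<^sub>R sym_unit i) j)"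

definition with_transpose :: "'n \<times> 'n \<Rightarrow> ('n \<times> 'n) set" where
  "with_transpose p = {p, prod.swap p}"

definition solves_reduced :: "'n::finite sqmat \<Rightarrow> ('n \<times> 'n) set \<Rightarrow> 'n sqmat \<Rightarrow> bool" where
  "solves_reduced \<Sigma> S Y \<longleftrightarrow>
     is_arg_min (objective \<Sigma>) (\<lambda>X. posdef X \<and> (\<forall>p \<in> off_diagonal - S. entry X p = 0)) Y"

definition greedy_choice :: "'n::finite sqmat \<Rightarrow> 'n sqmat \<Rightarrow> 'n \<times> 'n \<Rightarrow> bool" where
  "greedy_choice \<Sigma> X j \<longleftrightarrow>
     is_arg_min (line_min \<Sigma> X) (\<lambda>j. j \<in> off_zeros X) j \<and> line_min \<Sigma> X j < ereal (objective \<Sigma> X)"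

definition swap_choice :: "'n::finite sqmat \<Rightarrow> 'n sqmat \<Rightarrow> ('n \<times> 'n) \<times> ('n \<times> 'n) \<Rightarrow> bool" where
  "swap_choice \<Sigma> X ij \<longleftrightarrow>
     is_arg_min (swap_min \<Sigma> X) (\<lambda>ij. ij \<in> off_support X \<times> off_zeros X) ij \<and>
     swap_min \<Sigma> X ij < ereal (objective \<Sigma> X)"

datatype stage = Greedy | Swap | Done

(* Ties in the arg min are broken arbitrarily, hence a relation. The greedy loop is also left when
   the best candidate gives no decrease: X is then unchanged and the loop would never end. *)
inductive cwoa_step :: "'n::finite sqmat \<Rightarrow> nat \<Rightarrow> stage \<times> 'n sqmat \<Rightarrow> stage \<times> 'n sqmat \<Rightarrow> bool"
  for \<Sigma> :: "'n sqmat" and s :: nat where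
  greedy_add:
    "\<lbrakk>l0_off X < s; greedy_choice \<Sigma> X j;
      solves_reduced \<Sigma> (off_support X \<union> with_transpose j) Y\<rbrakk>
     \<Longrightarrow> cwoa_step \<Sigma> s (Greedy, X) (Greedy, Y)"
| greedy_exit:
    "\<not> (l0_off X < s \<and> (\<exists>j. greedy_choice \<Sigma> X j)) \<Longrightarrow> cwoa_step \<Sigma> s (Greedy, X) (Swap, X)"
| swap_move:
    "\<lbrakk>swap_choice \<Sigma> X (i, j);
      solves_reduced \<Sigma> ((off_support X - with_transpose i) \<union> with_transpose j) Y\<rbrakk>
     \<Longrightarrow> cwoa_step \<Sigma> s (Swap, X) (Greedy, Y)"
| swap_stop:
    "\<not> (\<exists>ij. swap_choice \<Sigma> X ij) \<Longrightarrow> cwoa_step \<Sigma> s (Swap, X) (Done, X)"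
| stopped:
    "cwoa_step \<Sigma> s (Done, X) (Done, X)"

definition diagonal_part :: "'n::finite sqmat \<Rightarrow> 'n sqmat" where
  "diagonal_part \<Sigma> = (\<chi> i j. if i = j then \<Sigma> $ i $ i else 0)"

(* The sequence of (stage, iterate) pairs; X^k stays the same while only the stage changes.
   A run that never reaches Done keeps working forever, so termination is not built in. What is
   built in is that the reduced problems that have to be solved do have a solution; this can fail
   for a singular covariance matrix, where the objective may be unbounded below. *)
definition cwoa_run :: "'n::finite sqmat \<Rightarrow> nat \<Rightarrow> (nat \<Rightarrow> stage \<times> 'n sqmat) \<Rightarrow> bool" where
  "cwoa_run \<Sigma> s c \<longleftrightarrow>
     c 0 = (Greedy, matrix_inv (diagonal_part \<Sigma>)) \<and> (\<forall>t. cwoa_step \<Sigma> s (c t) (c (Suc t)))"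

definition feasible :: "nat \<Rightarrow> 'n::finite sqmat \<Rightarrow> bool" where
  "feasible b X \<longleftrightarrow> posdef X \<and> l0_off X \<le> b"

definition neighbourhood :: "'n::finite sqmat \<Rightarrow> 'n sqmat set" where
  "neighbourhood X = {P. posdef P \<and> l0 (X - P) \<le> 2}"

(* A point of the problem with sparsity bound b is compared with the points of that problem only. *)
definition coordinatewise_minimum :: "'n::finite sqmat \<Rightarrow> nat \<Rightarrow> 'n sqmat \<Rightarrow> bool" where
  "coordinatewise_minimum \<Sigma> b X \<longleftrightarrow>
     feasible b X \<and> (\<forall>P \<in> neighbourhood X. feasible b P \<longrightarrow> objective \<Sigma> X \<le> objective \<Sigma> P)"

end

theory Submission
  imports Defs
begin

text \<open>
  Termination. Every move replaces the iterate by a minimiser of a reduced problem over a support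
  that also contains the support of the candidate that made the move attractive, so the objective
  drops strictly (\<open>greedy_add_decreases\<close>, \<open>swap_move_decreases\<close>). The minimal value of a reduced
  problem depends on its support alone and there are finitely many supports. Hence the number of
  supports whose minimal value lies below the current objective drops with every move. Without a
  move the run can only pass from one stage to the next, so it stops.

  Optimality. The iterate always minimises the objective among the positive definite matrices
  with its own support: for a solution of a reduced problem this is immediate, and for the
  starting point it is a one-variable inequality for each diagonal entry
  (\<open>initial_solves_reduced\<close>). Let \<open>P\<close> be a feasible point that differs from the output \<open>X\<close> in at
  most two positions. If every off-diagonal non-zero of \<open>P\<close> is one of \<open>X\<close>, the support of \<open>X\<close>
  already allows \<open>P\<close>, and \<open>X\<close> is at least as good. Otherwise \<open>P\<close> has a non-zero entry at an
  off-diagonal zero \<open>p\<close> of \<open>X\<close>; by symmetry the difference fills \<open>p\<close> and its transpose, which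
  are two positions, so \<open>P\<close> is \<open>X\<close> moved along the coordinate \<open>p\<close>. Then \<open>X\<close> has two off-diagonal
  non-zeros fewer than \<open>P\<close>, hence fewer than \<open>s\<close>, so the greedy stage was left because no
  single coordinate lowers the objective. In particular \<open>P\<close> does not.
\<close>

section \<open>Symmetric matrices and their off-diagonal entries\<close>

lemma entry_add: "entry (A + B) p = entry A p + entry B p"
  and entry_diff: "entry (A - B) p = entry A p - entry B p"
  and entry_scaleR: "entry (r *\<^sub>R A) p = r * entry A p"
  by (simp_all add: entry_def)

lemma entry_sym_unit: "entry (sym_unit p) q = (if q \<in> with_transpose p then 1 else 0)"
  by (cases p; cases q) (auto simp: entry_def sym_unit_def with_transpose_def)

lemma matrix_eq_entry: "A = B \<longleftrightarrow> (\<forall>p. entry A p = entry B p)"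
  by (auto simp: entry_def vec_eq_iff)

lemma entry_transpose: "entry (transpose A) p = entry A (prod.swap p)"
  by (simp add: entry_def transpose_def)

lemma symmetric_entry_swap: "transpose A = A \<Longrightarrow> entry A (prod.swap p) = entry A p"
  by (metis entry_transpose)

lemma posdef_symmetric: "posdef A \<Longrightarrow> transpose A = A"
  by (simp add: posdef_def)

lemma swap_off_diagonal [simp]: "prod.swap p \<in> off_diagonal \<longleftrightarrow> p \<in> off_diagonal"
  by (auto simp: off_diagonal_def)

lemma with_transpose_off_support:
  assumes "transpose A = A"
  shows "with_transpose p \<subseteq> off_support A \<longleftrightarrow> p \<in> off_support A"
  using symmetric_entry_swap[OF assms]
  by (auto simp: with_transpose_def off_support_def)

lemma card_with_transpose:
  assumes "p \<in> off_diagonal"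
  shows "card (with_transpose p) = 2"
  using assms by (cases p) (auto simp: with_transpose_def off_diagonal_def)

lemma card_with_transpose_le: "card (with_transpose p) \<le> 2"
  by (simp add: with_transpose_def card_insert_if)

text \<open>The off-diagonal support of a symmetric matrix is partitioned into transposed pairs.\<close>
lemma even_l0_off:
  assumes "transpose A = A"
  shows "even (l0_off A)"
proof -
  have U: "\<Union> (with_transpose ` off_support A) = off_support A"
  proof
    show "\<Union> (with_transpose ` off_support A) \<subseteq> off_support A"
      using with_transpose_off_support[OF assms] by blast
    show "off_support A \<subseteq> \<Union> (with_transpose ` off_support A)"
      by (auto simp: with_transpose_def)
  qed
  have "2 dvd card (\<Union> (with_transpose ` off_support A))"
  proof (rule dvd_partition)
    show "\<forall>c\<in>with_transpose ` off_support A. 2 dvd card c"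
      by (simp add: off_support_def card_with_transpose)
    show "\<forall>c1\<in>with_transpose ` off_support A. \<forall>c2\<in>with_transpose ` off_support A.
            c1 \<noteq> c2 \<longrightarrow> c1 \<inter> c2 = {}"
      by (auto simp: with_transpose_def)
  qed simp
  then show ?thesis
    by (simp add: U l0_off_def)
qed

section \<open>Reduced problems\<close>

text \<open>Phrasing the constraint as an inclusion of supports makes a restriction of the
  feasible set visible as a smaller support.\<close>
lemma solves_reduced_iff:
  fixes Y :: "'n::finite sqmat"
  shows "solves_reduced \<Sigma> S Y \<longleftrightarrow> posdef Y \<and> off_support Y \<subseteq> S \<and>
     (\<forall>X. posdef X \<longrightarrow> off_support X \<subseteq> S \<longrightarrow> objective \<Sigma> Y \<le> objective \<Sigma> X)"
proof -
  have "(\<forall>p \<in> off_diagonal - S. entry X p = 0) \<longleftrightarrow> off_support X \<subseteq> S" for X :: "'n sqmat"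
    by (auto simp: off_support_def)
  then show ?thesis
    unfolding solves_reduced_def is_arg_min_linorder by auto
qed

lemma line_min_less_witness:
  assumes "line_min \<Sigma> Y p < ereal v"
  obtains t where "posdef (Y + t *\<^sub>R sym_unit p)" "objective \<Sigma> (Y + t *\<^sub>R sym_unit p) < v"
  using assms unfolding line_min_def INF_less_iff by auto

lemma line_min_le:
  assumes "posdef (Y + t *\<^sub>R sym_unit p)"
  shows "line_min \<Sigma> Y p \<le> ereal (objective \<Sigma> (Y + t *\<^sub>R sym_unit p))"
  unfolding line_min_def by (rule INF_lower) (use assms in simp)

text \<open>The point on the line that beats \<open>X\<close> is itself admissible for the reduced problem.\<close>
lemma greedy_add_decreases:
  assumes "greedy_choice \<Sigma> X j" "solves_reduced \<Sigma> (off_support X \<union> with_transpose j) Y"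
  shows "objective \<Sigma> Y < objective \<Sigma> X"
proof -
  have "line_min \<Sigma> X j < ereal (objective \<Sigma> X)"
    using assms(1) by (simp add: greedy_choice_def)
  then obtain t where t: "posdef (X + t *\<^sub>R sym_unit j)"
      "objective \<Sigma> (X + t *\<^sub>R sym_unit j) < objective \<Sigma> X"
    by (rule line_min_less_witness)
  have "off_support (X + t *\<^sub>R sym_unit j) \<subseteq> off_support X \<union> with_transpose j"
    by (auto simp: off_support_def entry_add entry_scaleR entry_sym_unit split: if_splits)
  then show ?thesis
    using t assms(2) unfolding solves_reduced_iff by fastforce
qed

text \<open>As for a greedy addition; by symmetry, subtracting the multiple of the symmetric unit clears
  the entry at \<open>i\<close> and the one at its transpose, so the candidate respects the new support.\<close>
lemma swap_move_decreases:
  assumes "transpose X = X" "swap_choice \<Sigma> X (i, j)"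
    and "solves_reduced \<Sigma> ((off_support X - with_transpose i) \<union> with_transpose j) Y"
  shows "objective \<Sigma> Y < objective \<Sigma> X"
proof -
  let ?Z = "X - entry X i *\<^sub>R sym_unit i"
  have "line_min \<Sigma> ?Z j < ereal (objective \<Sigma> X)"
    using assms(2) by (simp add: swap_choice_def swap_min_def)
  then obtain t where t: "posdef (?Z + t *\<^sub>R sym_unit j)"
      "objective \<Sigma> (?Z + t *\<^sub>R sym_unit j) < objective \<Sigma> X"
    by (rule line_min_less_witness)
  have "entry X q = entry X i" if "q \<in> with_transpose i" for q
    using that symmetric_entry_swap[OF assms(1), of i] by (auto simp: with_transpose_def)
  then have "off_support (?Z + t *\<^sub>R sym_unit j) \<subseteq> (off_support X - with_transpose i) \<union> with_transpose j"
    by (auto simp: off_support_def entry_add entry_diff entry_scaleR entry_sym_unit split: if_splits)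
  then show ?thesis
    using t assms(3) unfolding solves_reduced_iff by fastforce
qed

section \<open>The starting point\<close>

text \<open>The quadratic form evaluated at a standard basis vector is a diagonal entry.\<close>
lemma posdef_diagonal_entry_pos:
  assumes "posdef A"
  shows "0 < A $ i $ i"
proof -
  have "0 < axis i 1 \<bullet> (A *v axis i 1)"
    using assms unfolding posdef_def by (metis axis_eq_0_iff one_neq_zero)
  then show ?thesis
    by (simp add: matrix_vector_mult_basis inner_axis' column_def)
qed

lemma covariance_matrix_diagonal_entry_nonneg:
  assumes "covariance_matrix A"
  shows "0 \<le> A $ i $ i"
proof -
  have "0 \<le> axis i 1 \<bullet> (A *v axis i 1)"
    using assms unfolding covariance_matrix_def by blast
  then show ?thesis
    by (simp add: matrix_vector_mult_basis inner_axis' column_def)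
qed

lemma off_support_empty_iff: "off_support A = {} \<longleftrightarrow> (\<forall>i j. i \<noteq> j \<longrightarrow> A $ i $ j = 0)"
  by (auto simp: off_support_def off_diagonal_def entry_def)

lemma posdef_diagonal:
  assumes "off_support A = {}" "\<And>i. 0 < A $ i $ i"
  shows "posdef A"
proof -
  have off: "A $ i $ j = 0" if "i \<noteq> j" for i j
    using assms(1) that by (simp add: off_support_empty_iff)
  have "transpose A = A"
    by (simp add: transpose_def vec_eq_iff) (metis off)
  moreover have "0 < x \<bullet> (A *v x)" if x: "x \<noteq> 0" for x
  proof -
    have "(A *v x) $ i = A $ i $ i * x $ i" for i
    proof -
      have "(A *v x) $ i = (\<Sum>j\<in>UNIV. if j = i then A $ i $ i * x $ i else 0)"
        unfolding matrix_vector_mult_def vec_lambda_beta by (rule sum.cong) (auto simp: off)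
      then show ?thesis by simp
    qed
    then have eq: "x \<bullet> (A *v x) = (\<Sum>i\<in>UNIV. A $ i $ i * (x $ i)\<^sup>2)"
      by (simp add: inner_vec_def power2_eq_square algebra_simps)
    obtain k where "x $ k \<noteq> 0"
      using x by (auto simp: vec_eq_iff)
    then show ?thesis
      unfolding eq using assms(2) by (intro sum_pos2[of _ k]) (auto simp: less_imp_le)
  qed
  ultimately show ?thesis
    by (simp add: posdef_def)
qed

lemma objective_diagonal:
  assumes "off_support D = {}" "\<And>i. 0 < D $ i $ i"
  shows "objective \<Sigma> D = (\<Sum>i\<in>UNIV. \<Sigma> $ i $ i * D $ i $ i - ln (D $ i $ i))"
proof -
  have off: "D $ i $ j = 0" if "i \<noteq> j" for i j
    using assms(1) that by (simp add: off_support_empty_iff)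
  have "(\<Sigma> $ i) \<bullet> (D $ i) = \<Sigma> $ i $ i * D $ i $ i" for i
  proof -
    have "(\<Sigma> $ i) \<bullet> (D $ i) = (\<Sum>j\<in>UNIV. if j = i then \<Sigma> $ i $ i * D $ i $ i else 0)"
      unfolding inner_vec_def inner_real_def by (rule sum.cong) (auto simp: off)
    then show ?thesis by simp
  qed
  then have "\<Sigma> \<bullet> D = (\<Sum>i\<in>UNIV. \<Sigma> $ i $ i * D $ i $ i)"
    by (simp add: inner_vec_def[of \<Sigma> D])
  moreover have "ln (\<Prod>i\<in>UNIV. D $ i $ i) = (\<Sum>i\<in>UNIV. ln (D $ i $ i))"
    by (rule ln_prod) (simp_all add: assms(2) less_imp_neq[symmetric])
  moreover have "det D = (\<Prod>i\<in>UNIV. D $ i $ i)"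
    using off by (rule det_diagonal)
  ultimately show ?thesis
    by (simp add: objective_def sum_subtractf)
qed

lemma diagonal_inverse_entries:
  assumes "invertible (diagonal_part \<Sigma>)"
  shows "\<Sigma> $ i $ i * matrix_inv (diagonal_part \<Sigma>) $ i $ j = (if i = j then 1 else 0)"
proof -
  let ?B = "matrix_inv (diagonal_part \<Sigma>)"
  have "(diagonal_part \<Sigma> ** ?B) $ i $ j = (\<Sum>k\<in>UNIV. if k = i then \<Sigma> $ i $ i * ?B $ i $ j else 0)"
    unfolding matrix_matrix_mult_def vec_lambda_beta
    by (rule sum.cong) (auto simp: diagonal_part_def[of \<Sigma>])
  moreover have "diagonal_part \<Sigma> ** ?B = mat 1"
    using someI_ex[OF assms[unfolded invertible_def]] by (simp add: matrix_inv_def)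
  ultimately show ?thesis
    by (simp add: mat_def)
qed

text \<open>On diagonal matrices the objective separates into \<open>\<sigma> * d - ln d\<close> for each diagonal entry,
  and \<open>ln x \<le> x - 1\<close> at \<open>x = \<sigma> * d\<close> shows that \<open>d = 1 / \<sigma>\<close> is best.\<close>
lemma initial_solves_reduced:
  assumes "covariance_matrix \<Sigma>" "invertible (diagonal_part \<Sigma>)"
  shows "solves_reduced \<Sigma> {} (matrix_inv (diagonal_part \<Sigma>))"
proof -
  let ?B = "matrix_inv (diagonal_part \<Sigma>)"
  note B = diagonal_inverse_entries[OF assms(2)]
  have pos: "0 < \<Sigma> $ i $ i" for i
    using B[of i i] covariance_matrix_diagonal_entry_nonneg[OF assms(1), of i]
    by (cases "\<Sigma> $ i $ i = 0") auto
  have Bii: "?B $ i $ i = 1 / \<Sigma> $ i $ i" for i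
    using B[of i i] pos[of i] by (simp add: field_simps)
  have Bpos: "0 < ?B $ i $ i" for i
    using pos by (simp add: Bii)
  have Boff: "off_support ?B = {}"
    unfolding off_support_empty_iff using B pos by (metis less_irrefl mult_eq_0_iff)
  have "objective \<Sigma> ?B \<le> objective \<Sigma> D" if D: "posdef D" "off_support D \<subseteq> {}" for D
  proof -
    have Dpos: "0 < D $ i $ i" for i
      using D(1) by (rule posdef_diagonal_entry_pos)
    have "\<Sigma> $ i $ i * ?B $ i $ i - ln (?B $ i $ i) \<le> \<Sigma> $ i $ i * D $ i $ i - ln (D $ i $ i)" for i
    proof -
      have "ln (\<Sigma> $ i $ i * D $ i $ i) \<le> \<Sigma> $ i $ i * D $ i $ i - 1"
        using pos[of i] Dpos[of i] by (intro ln_le_minus_one) simp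
      then show ?thesis
        using pos[of i] Dpos[of i] by (simp add: Bii ln_mult ln_div)
    qed
    then show ?thesis
      using D(2) Dpos Bpos by (simp add: objective_diagonal Boff sum_mono)
  qed
  then show ?thesis
    using posdef_diagonal[OF Boff Bpos] Boff by (simp add: solves_reduced_iff)
qed

section \<open>Properties kept along a run\<close>

text \<open>The least even number that is at least \<open>s\<close>: a symmetric matrix with fewer than \<open>s\<close> non-zero
  off-diagonal entries can gain a transposed pair and still respects this bound.\<close>
definition even_bound :: "nat \<Rightarrow> nat" where
  "even_bound s = (if even s then s else s + 1)"

lemma solves_reduced_feasible:
  assumes "solves_reduced \<Sigma> S Y" "card S \<le> b"
  shows "feasible b Y"
  using assms card_mono[OF finite, of "off_support Y" S]
  by (simp add: solves_reduced_iff feasible_def l0_off_def)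

lemma solves_reduced_own_support:
  assumes "solves_reduced \<Sigma> S Y"
  shows "solves_reduced \<Sigma> (off_support Y) Y"
  using assms by (auto simp: solves_reduced_iff)

text \<open>Being a minimiser over its own support is remembered for the comparison with points of the
  same support; the condition under which the greedy stage was left is remembered for the
  comparison with points that have one more pair of non-zero entries.\<close>
fun cwoa_invariant :: "'n::finite sqmat \<Rightarrow> nat \<Rightarrow> stage \<times> 'n sqmat \<Rightarrow> bool" where
  "cwoa_invariant \<Sigma> s (g, X) \<longleftrightarrow>
     feasible (even_bound s) X \<and> solves_reduced \<Sigma> (off_support X) X \<and>
     (g \<noteq> Greedy \<longrightarrow> \<not> (l0_off X < s \<and> (\<exists>j. greedy_choice \<Sigma> X j)))"

lemma card_add_pair_le:
  assumes "transpose X = X" "l0_off X < s"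
  shows "card (off_support X \<union> with_transpose j) \<le> even_bound s"
proof -
  have "l0_off X + 2 \<le> even_bound s"
    using even_l0_off[OF assms(1)] assms(2) unfolding even_bound_def by presburger
  then show ?thesis
    using card_Un_le[of "off_support X" "with_transpose j"] card_with_transpose_le[of j]
    by (simp add: l0_off_def)
qed

lemma card_swap_pair_le:
  assumes "transpose X = X" "i \<in> off_support X"
  shows "card ((off_support X - with_transpose i) \<union> with_transpose j) \<le> l0_off X"
proof -
  have sub: "with_transpose i \<subseteq> off_support X"
    using assms with_transpose_off_support by blast
  have "card (with_transpose i) = 2"
    using assms(2) by (intro card_with_transpose) (simp add: off_support_def)
  then have "card (off_support X - with_transpose i) + 2 = l0_off X"
    using sub card_mono[OF finite sub] by (simp add: card_Diff_subset l0_off_def)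
  then show ?thesis
    using card_Un_le[of "off_support X - with_transpose i" "with_transpose j"]
      card_with_transpose_le[of j] by linarith
qed

lemma cwoa_step_invariant:
  assumes "cwoa_step \<Sigma> s a b" "cwoa_invariant \<Sigma> s a"
  shows "cwoa_invariant \<Sigma> s b"
  using assms
proof cases
  case (greedy_add X j Y)
  have "transpose X = X"
    using assms(2) greedy_add(1) by (simp add: feasible_def posdef_symmetric)
  from card_add_pair_le[OF this greedy_add(3)] show ?thesis
    using greedy_add solves_reduced_feasible solves_reduced_own_support by (metis cwoa_invariant.simps)
next
  case (swap_move X i j Y)
  have X: "transpose X = X" "l0_off X \<le> even_bound s"
    using assms(2) swap_move(1) by (simp_all add: feasible_def posdef_symmetric)
  have "i \<in> off_support X"
    using swap_move(3) by (auto simp: swap_choice_def is_arg_min_def)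
  from card_swap_pair_le[OF X(1) this] X(2)
  have "card ((off_support X - with_transpose i) \<union> with_transpose j) \<le> even_bound s"
    using order_trans by blast
  then show ?thesis
    using swap_move solves_reduced_feasible solves_reduced_own_support by (metis cwoa_invariant.simps)
qed auto

section \<open>Termination\<close>

definition better_supports :: "'n::finite sqmat \<Rightarrow> 'n sqmat \<Rightarrow> ('n \<times> 'n) set set" where
  "better_supports \<Sigma> X = {S. \<exists>Y. solves_reduced \<Sigma> S Y \<and> objective \<Sigma> Y < objective \<Sigma> X}"

text \<open>The support \<open>S\<close> that was just solved leaves the set, since its minimal value is now attained;
  no support enters, since the objective only went down.\<close>
lemma card_better_supports_less:
  assumes "solves_reduced \<Sigma> S Y" "objective \<Sigma> Y < objective \<Sigma> X"
  shows "card (better_supports \<Sigma> Y) < card (better_supports \<Sigma> X)"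
proof (rule psubset_card_mono)
  have "S \<in> better_supports \<Sigma> X"
    using assms by (auto simp: better_supports_def)
  moreover have "S \<notin> better_supports \<Sigma> Y"
    using assms(1) by (force simp: better_supports_def solves_reduced_iff)
  moreover have "better_supports \<Sigma> Y \<subseteq> better_supports \<Sigma> X"
    using assms(2) by (force simp: better_supports_def)
  ultimately show "better_supports \<Sigma> Y \<subset> better_supports \<Sigma> X"
    by blast
qed simp

text \<open>A move may send the run from \<open>Swap\<close> back to \<open>Greedy\<close>, which raises the stage by one; the
  factor 3 makes the loss of a single better support outweigh this.\<close>
fun cwoa_measure :: "'n::finite sqmat \<Rightarrow> stage \<times> 'n sqmat \<Rightarrow> nat" where
  "cwoa_measure \<Sigma> (g, X) =
     3 * card (better_supports \<Sigma> X) + (case g of Greedy \<Rightarrow> 2 | Swap \<Rightarrow> 1 | Done \<Rightarrow> 0)"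

lemma cwoa_step_measure:
  assumes "cwoa_step \<Sigma> s a b" "cwoa_invariant \<Sigma> s a" "fst a \<noteq> Done"
  shows "cwoa_measure \<Sigma> b < cwoa_measure \<Sigma> a"
  using assms
proof cases
  case (greedy_add X j Y)
  show ?thesis
    using card_better_supports_less[OF greedy_add(5) greedy_add_decreases[OF greedy_add(4,5)]]
      greedy_add by simp
next
  case (swap_move X i j Y)
  have "transpose X = X"
    using assms(2) swap_move(1) by (simp add: feasible_def posdef_symmetric)
  from card_better_supports_less[OF swap_move(4) swap_move_decreases[OF this swap_move(3,4)]]
  show ?thesis
    using swap_move by simp
qed (use assms in auto)

section \<open>Optimality of the output\<close>

text \<open>Among the finitely many zero positions one has the least line minimum. If even this one does
  not improve on \<open>X\<close>, no position does.\<close>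
lemma greedy_exit_line_optimal:
  assumes "\<not> (\<exists>j. greedy_choice \<Sigma> X j)" "p \<in> off_zeros X" "posdef (X + t *\<^sub>R sym_unit p)"
  shows "objective \<Sigma> X \<le> objective \<Sigma> (X + t *\<^sub>R sym_unit p)"
proof -
  obtain j where j: "is_arg_min (line_min \<Sigma> X) (\<lambda>j. j \<in> off_zeros X) j"
    using ex_is_arg_min_if_finite[of "off_zeros X" "line_min \<Sigma> X"] assms(2) by auto
  have "ereal (objective \<Sigma> X) \<le> line_min \<Sigma> X j"
    using assms(1) j unfolding greedy_choice_def by (meson not_less)
  also have "\<dots> \<le> line_min \<Sigma> X p"
    using j assms(2) unfolding is_arg_min_linorder by blast
  also have "\<dots> \<le> ereal (objective \<Sigma> (X + t *\<^sub>R sym_unit p))"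
    using assms(3) by (rule line_min_le)
  finally show ?thesis
    by simp
qed

text \<open>A non-zero off-diagonal position and its transpose already use up both entries.\<close>
lemma symmetric_two_entries_off_diagonal:
  assumes "transpose D = D" "l0 D \<le> 2" "p \<in> off_support D"
  shows "D = entry D p *\<^sub>R sym_unit p"
proof -
  have p: "p \<in> off_diagonal"
    using assms(3) by (simp add: off_support_def)
  have "with_transpose p \<subseteq> off_support D"
    using assms with_transpose_off_support by blast
  then have sub: "with_transpose p \<subseteq> {q. entry D q \<noteq> 0}"
    by (auto simp: off_support_def)
  have "with_transpose p = {q. entry D q \<noteq> 0}"
    using card_seteq[OF finite sub] assms(2) card_with_transpose[OF p] by (simp add: l0_def)
  then have "entry D q = 0" if "q \<notin> with_transpose p" for q
    using that by blast
  moreover have "entry D q = entry D p" if "q \<in> with_transpose p" for q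
    using that symmetric_entry_swap[OF assms(1), of p] by (auto simp: with_transpose_def)
  ultimately show ?thesis
    by (simp add: matrix_eq_entry entry_scaleR entry_sym_unit)
qed

lemma exit_point_coordinatewise_minimum:
  assumes "feasible (even_bound s) X" "solves_reduced \<Sigma> (off_support X) X"
    and exit: "\<not> (l0_off X < s \<and> (\<exists>j. greedy_choice \<Sigma> X j))"
  shows "coordinatewise_minimum \<Sigma> (even_bound s) X"
  unfolding coordinatewise_minimum_def
proof (intro conjI ballI impI assms(1))
  fix P assume P: "P \<in> neighbourhood X" "feasible (even_bound s) P"
  have symX: "transpose X = X" and symP: "transpose P = P" and pP: "posdef P"
    using assms(1) P by (auto simp: feasible_def posdef_symmetric)
  show "objective \<Sigma> X \<le> objective \<Sigma> P"
  proof (cases "off_support P \<subseteq> off_support X")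
    case True
    then show ?thesis
      using assms(2) pP by (auto simp: solves_reduced_iff)
  next
    case False
    then obtain p where p: "p \<in> off_support P" "p \<in> off_zeros X"
      by (auto simp: off_support_def off_zeros_def)
    define t where "t = entry P p"
    have "P - X = entry (P - X) p *\<^sub>R sym_unit p"
    proof (rule symmetric_two_entries_off_diagonal)
      show "transpose (P - X) = P - X"
        using symmetric_entry_swap[OF symX] symmetric_entry_swap[OF symP]
        unfolding matrix_eq_entry entry_transpose entry_diff by metis
      show "l0 (P - X) \<le> 2"
      proof -
        have "{q. entry (P - X) q \<noteq> 0} = {q. entry (X - P) q \<noteq> 0}"
          by (auto simp: entry_diff)
        then show ?thesis
          using P(1) by (simp add: neighbourhood_def l0_def)
      qed
      show "p \<in> off_support (P - X)"
        using p by (simp add: off_support_def off_zeros_def entry_diff)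
    qed
    \<comment> \<open>As \<open>p\<close> is a zero of \<open>X\<close>, the step length is the entry of \<open>P\<close> itself.\<close>
    then have PX: "P = X + t *\<^sub>R sym_unit p"
      using p(2) by (simp add: t_def entry_diff off_zeros_def algebra_simps)
    have "off_support X \<union> with_transpose p \<subseteq> off_support P"
    proof (rule Un_least)
      have "entry P q = entry X q" if "q \<in> off_support X - with_transpose p" for q
        using that by (simp add: PX entry_add entry_scaleR entry_sym_unit)
      then have "off_support X - with_transpose p \<subseteq> off_support P"
        unfolding off_support_def by fastforce
      moreover show "with_transpose p \<subseteq> off_support P"
        using p(1) symP with_transpose_off_support by blast
      ultimately show "off_support X \<subseteq> off_support P"
        by blast
    qed
    moreover have "off_support X \<inter> with_transpose p = {}"
      using p(2) symmetric_entry_swap[OF symX, of p]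
      by (auto simp: off_support_def off_zeros_def with_transpose_def)
    ultimately have "l0_off X + card (with_transpose p) \<le> l0_off P"
      using card_mono[OF finite, of "off_support X \<union> with_transpose p" "off_support P"]
        card_Un_disjoint[OF finite finite, of "off_support X" "with_transpose p"]
      by (simp add: l0_off_def)
    moreover have "card (with_transpose p) = 2"
      using p(2) by (intro card_with_transpose) (simp add: off_zeros_def)
    ultimately have "l0_off X < s"
      using P(2) by (simp add: feasible_def even_bound_def split: if_splits)
    then show ?thesis
      using exit greedy_exit_line_optimal[of \<Sigma> X p t] p(2) pP by (simp add: PX)
  qed
qed

(* Symmetric matrices have an even number of non-zero off-diagonal entries and the greedy stage
   goes on while this number is below s, so an odd s acts as the bound s + 1. *)
theorem proposition1:
  fixes \<Sigma> :: "real ^ 'n ^ 'n" and s :: nat and c :: "nat \<Rightarrow> stage \<times> (real ^ 'n ^ 'n)"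
  assumes "covariance_matrix \<Sigma>"
    and "invertible (diagonal_part \<Sigma>)"
    and "s > 0"
    and "cwoa_run \<Sigma> s c"
  shows "\<exists>t X. c t = (Done, X) \<and>
           coordinatewise_minimum \<Sigma> (if even s then s else s + 1) X"
proof -
  have c0: "c 0 = (Greedy, matrix_inv (diagonal_part \<Sigma>))"
    and step: "cwoa_step \<Sigma> s (c t) (c (Suc t))" for t
    using assms(4) by (auto simp: cwoa_run_def)
  note init = initial_solves_reduced[OF assms(1,2)]
  have inv: "cwoa_invariant \<Sigma> s (c t)" for t
  proof (induction t)
    case 0
    show ?case
      using solves_reduced_feasible[OF init, of "even_bound s"] solves_reduced_own_support[OF init]
      by (simp add: c0)
  next
    case (Suc t)
    then show ?case
      using cwoa_step_invariant step by blast
  qed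
  \<comment> \<open>Where the measure is least along the run, the next step cannot lower it.\<close>
  obtain t where t: "\<And>u. cwoa_measure \<Sigma> (c t) \<le> cwoa_measure \<Sigma> (c u)"
    using ex_has_least_nat[of "\<lambda>_. True" _ "\<lambda>t. cwoa_measure \<Sigma> (c t)"] by auto
  obtain g X where ct: "c t = (g, X)"
    by fastforce
  have "g = Done"
    using cwoa_step_measure[OF step inv, of t] t[of "Suc t"] by (auto simp: ct)
  moreover from this have "coordinatewise_minimum \<Sigma> (even_bound s) X"
    using inv[of t] by (intro exit_point_coordinatewise_minimum) (auto simp: ct)
  ultimately show ?thesis
    using ct unfolding even_bound_def by blast
qed

end
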